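(* There exist a finite set of prototiles $\mathcal{F}$ in $\mathbb{R}^2$ and primitive substitution rules $\varrho_1,\varrho_2$ on $\mathcal{F}$ with equal substitution matrices $M_{\varrho_1}=M_{\varrho_2}$, such that: (i) every tiling in $\mathbb{X}_{\varrho_1}$ is periodic; in particular any Delone set associated with such a tiling is BD equivalent to a lattice; (ii) every Delone set associated with a tiling in $\mathbb{X}_{\varrho_2}$ is BD non-equivalent to every lattice in $\mathbb{R}^2$. In particular, if $\Lambda_1$ is associated with a tiling in $\mathbb{X}_{\varrho_1}$ and $\Lambda_2$ with a tiling in $\mathbb{X}_{\varrho_2}$, then $\Lambda_1$ and $\Lambda_2$ are not BD equivalent.
   Context: A Delone set in $\mathbb{R}^d$ is a set $\Lambda$ for which there are $r,R>0$ such that every ball of radius $r$ contains at most one point of $\Lambda$ and every ball of radius $R$ contains at least one. Two Delone sets $\Lambda,\Lambda'$ are BD (bounded displacement) equivalent if there exist $\alpha>0$ and a bijection $\phi:\Lambda\to\alpha\Lambda'$ with $\sup_{x\in\Lambda}\|x-\phi(x)\|<\infty$. A tile is a compact set equal to the closure of its interior (here squares/rectangles). A tessellation of $U\subset\mathbb{R}^d$ is a collection of tiles with pairwise disjoint interiors whose union is $U$; a patch is a tessellation of a bounded set $U$ (its support), and a tiling is a tessellation of $\mathbb{R}^d$. A finite set $\mathcal{F}=\{T_1,\dots,T_n\}$ of prototiles is fixed; a tile is of type $i$ if it is a translate of $T_i$, and $\mathcal{F}^*$ denotes the set of patches consisting of translates of prototiles, up to translation. A substitution rule on $\mathcal{F}$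 with inflation factor $\xi>1$ is a map $\varrho:\mathcal{F}\to\mathcal{F}^*$ such that $\varrho(T_i)$ is a patch with support $\xi T_i$ for each $i$; it is extended to patches and tilings by applying it to each tile individually (replacing a tile $T_i+t$ by $\varrho(T_i)+\xi t$). The substitution tiling space $\mathbb{X}_\varrho$ is the set of tilings $\mathcal{T}$ of $\mathbb{R}^d$ such that every finite patch of $\mathcal{T}$ is a translate of a sub-patch of some $\varrho^m(T)$, $m\in\mathbb{N}$, $T\in\mathcal{F}$. The substitution matrix $M_\varrho$ has entries $a_{ij}=$ number of tiles of type $i$ in $\varrho(T_j)$; $\varrho$ is primitive if some power of $M_\varrho$ has all entries positive. A Delone set is associated with a tiling if it is obtained by choosing one point in each tile, distinct tiles giving distinct points. A tiling is periodic if its group of translational symmetries contains $d$ linearly independent vectors. *)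

theory Defs
  imports "HOL-Analysis.Analysis"
begin

type_synonym pt = "real^2"

text \<open>A labelled tile (i, t) stands for the translate T i + t of the i-th prototile.\<close>
type_synonym ltile = "nat \<times> pt"

definition tile_of :: "(nat \<Rightarrow> pt set) \<Rightarrow> ltile \<Rightarrow> pt set" where
  "tile_of T p = (\<lambda>x. x + snd p) ` T (fst p)"

definition is_tile :: "pt set \<Rightarrow> bool" where
  "is_tile A \<longleftrightarrow> compact A \<and> closure (interior A) = A \<and> interior A \<noteq> {}"

text \<open>A finite family of n prototiles T 0, ..., T (n-1), pairwise not translates of each other
  (so that the type of a tile is well defined).\<close>
definition prototiles :: "nat \<Rightarrow> (nat \<Rightarrow> pt set) \<Rightarrow> bool" where
  "prototiles n T \<longleftrightarrow> n > 0 \<and> (\<forall>i<n. is_tile (T i)) \<and>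
     (\<forall>i<n. \<forall>j<n. i \<noteq> j \<longrightarrow> (\<forall>v. T j \<noteq> (\<lambda>x. x + v) ` T i))"

definition tessellation :: "nat \<Rightarrow> (nat \<Rightarrow> pt set) \<Rightarrow> ltile set \<Rightarrow> pt set \<Rightarrow> bool" where
  "tessellation n T P U \<longleftrightarrow> (\<forall>p\<in>P. fst p < n) \<and>
     (\<forall>p\<in>P. \<forall>q\<in>P. p \<noteq> q \<longrightarrow> interior (tile_of T p) \<inter> interior (tile_of T q) = {}) \<and>
     \<Union> (tile_of T ` P) = U"

definition subst_rule :: "nat \<Rightarrow> (nat \<Rightarrow> pt set) \<Rightarrow> real \<Rightarrow> (nat \<Rightarrow> ltile set) \<Rightarrow> bool" where
  "subst_rule n T \<xi> \<rho> \<longleftrightarrow> \<xi> > 1 \<and>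
     (\<forall>i<n. finite (\<rho> i) \<and> tessellation n T (\<rho> i) ((\<lambda>x. \<xi> *\<^sub>R x) ` T i))"

definition subst_apply :: "real \<Rightarrow> (nat \<Rightarrow> ltile set) \<Rightarrow> ltile set \<Rightarrow> ltile set" where
  "subst_apply \<xi> \<rho> P = {(j, \<xi> *\<^sub>R t + s) | i t j s. (i, t) \<in> P \<and> (j, s) \<in> \<rho> i}"

definition shift :: "pt \<Rightarrow> ltile set \<Rightarrow> ltile set" where
  "shift v P = (\<lambda>p. (fst p, snd p + v)) ` P"

definition tiling_space :: "nat \<Rightarrow> (nat \<Rightarrow> pt set) \<Rightarrow> real \<Rightarrow> (nat \<Rightarrow> ltile set) \<Rightarrow> ltile set set" where
  "tiling_space n T \<xi> \<rho> = {P. tessellation n T P UNIV \<and>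
     (\<forall>Q. Q \<subseteq> P \<and> finite Q \<longrightarrow>
        (\<exists>m j v. j < n \<and> shift v Q \<subseteq> (subst_apply \<xi> \<rho> ^^ m) {(j, 0)}))}"

definition subst_matrix :: "(nat \<Rightarrow> ltile set) \<Rightarrow> nat \<Rightarrow> nat \<Rightarrow> nat" where
  "subst_matrix \<rho> i j = card {s. (i, s) \<in> \<rho> j}"

fun matpow :: "nat \<Rightarrow> (nat \<Rightarrow> nat \<Rightarrow> nat) \<Rightarrow> nat \<Rightarrow> nat \<Rightarrow> nat \<Rightarrow> nat" where
  "matpow n M 0 = (\<lambda>i j. if i = j then 1 else 0)"
| "matpow n M (Suc k) = (\<lambda>i j. \<Sum>l<n. M i l * matpow n M k l j)"

definition primitive :: "nat \<Rightarrow> (nat \<Rightarrow> ltile set) \<Rightarrow> bool" where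
  "primitive n \<rho> \<longleftrightarrow> (\<exists>k\<ge>1. \<forall>i<n. \<forall>j<n. matpow n (subst_matrix \<rho>) k i j > 0)"

definition lin_indep2 :: "pt \<Rightarrow> pt \<Rightarrow> bool" where
  "lin_indep2 u v \<longleftrightarrow> u$1 * v$2 - u$2 * v$1 \<noteq> 0"

definition periodic_tiling :: "ltile set \<Rightarrow> bool" where
  "periodic_tiling P \<longleftrightarrow> (\<exists>u v. lin_indep2 u v \<and> shift u P = P \<and> shift v P = P)"

definition delone :: "pt set \<Rightarrow> bool" where
  "delone L \<longleftrightarrow> (\<exists>r R. r > 0 \<and> R > 0 \<and>
     (\<forall>x. \<forall>a\<in>L. \<forall>b\<in>L. a \<in> ball x r \<and> b \<in> ball x r \<longrightarrow> a = b) \<and>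
     (\<forall>x. L \<inter> ball x R \<noteq> {}))"

definition bd_equiv :: "pt set \<Rightarrow> pt set \<Rightarrow> bool" where
  "bd_equiv L L' \<longleftrightarrow> (\<exists>\<alpha>>0. \<exists>\<phi>. bij_betw \<phi> L ((\<lambda>x. \<alpha> *\<^sub>R x) ` L') \<and>
     (\<exists>C. \<forall>x\<in>L. norm (x - \<phi> x) \<le> C))"

definition lattice2 :: "pt set \<Rightarrow> bool" where
  "lattice2 L \<longleftrightarrow> (\<exists>u v. lin_indep2 u v \<and>
     L = {of_int a *\<^sub>R u + of_int b *\<^sub>R v | a b. True})"

definition associated :: "(nat \<Rightarrow> pt set) \<Rightarrow> ltile set \<Rightarrow> pt set \<Rightarrow> bool" where
  "associated T P L \<longleftrightarrow> (\<exists>f. (\<forall>p\<in>P. f p \<in> tile_of T p) \<and> inj_on f P \<and> L = f ` P)"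

end

theory Submission
  imports Defs
begin

text \<open>The prototiles are the unit square (type 0) and the 3 by 1 rectangle (type 1), with inflation
  factor 3. Every inflated tile is cut into three rows of height 1, each filled by tiles of one type;
  the two rules differ only in the order of these rows. On row types the first rule is
  a -> aba, b -> bab and produces alternating rows. The second is a -> aab, b -> bba, so row n of a
  supertile of type j has type j + (number of ternary digits 2 of n) mod 2. The row matrix has the
  eigenvalue 1, and in the second case half supertiles of the two types show a difference of row
  counts that grows with the level. Since rows can be taken arbitrarily long for a fixed
  height, this difference is not compensated along the boundary of a rectangle, whereas a set that is
  BD equivalent to a lattice has nearly the same number of points in any two translates of a
  rectangle.\<close>

section \<open>Coordinates in the plane and the two strip prototiles\<close>

definition pt2 :: "real \<Rightarrow> real \<Rightarrow> pt" where
  "pt2 x y = vector [x, y]"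

lemma pt2_nth [simp]: "pt2 x y $ 1 = x" "pt2 x y $ 2 = y"
  by (simp_all add: pt2_def)

lemma pt_eq_iff: "(a :: pt) = b \<longleftrightarrow> a$1 = b$1 \<and> a$2 = b$2"
  by (simp add: vec_eq_iff forall_2)

lemma norm_pt_le: "norm (a :: pt) \<le> \<bar>a$1\<bar> + \<bar>a$2\<bar>"
  using norm_le_l1_cart[of a] by (simp add: sum_2)

text \<open>The width is written as a power so that an inflated tile of type \<open>c\<close> has
  width \<open>3 ^ (c + 1)\<close> and both types are handled uniformly.\<close>

definition strip :: "nat \<Rightarrow> pt set" where
  "strip c = cbox 0 (pt2 (3 ^ c) 1)"

lemma tile_of_strip: "tile_of strip (c, t) = cbox t (t + pt2 (3 ^ c) 1)"
proof -
  have "tile_of strip (c, t) = (+) t ` cbox 0 (pt2 (3 ^ c) 1)"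
    by (simp add: tile_of_def strip_def add.commute)
  also have "\<dots> = cbox t (t + pt2 (3 ^ c) 1)"
    by (subst cbox_translation[symmetric]) simp
  finally show ?thesis .
qed

lemma mem_tile_of_strip:
  "x \<in> tile_of strip (c, t) \<longleftrightarrow> t$1 \<le> x$1 \<and> x$1 \<le> t$1 + 3 ^ c \<and> t$2 \<le> x$2 \<and> x$2 \<le> t$2 + 1"
  by (auto simp: tile_of_strip mem_box_cart forall_2)

lemma mem_interior_tile_of_strip:
  "x \<in> interior (tile_of strip (c, t)) \<longleftrightarrow>
     t$1 < x$1 \<and> x$1 < t$1 + 3 ^ c \<and> t$2 < x$2 \<and> x$2 < t$2 + 1"
  by (auto simp: tile_of_strip interior_cbox mem_box_cart forall_2)

lemma is_tile_strip: "is_tile (strip c)"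
proof -
  have "pt2 (1/2) (1/2) \<in> box 0 (pt2 (3 ^ c) 1)"
    using one_le_power[of "3::real" c] by (auto simp: mem_box_cart forall_2 intro: less_le_trans[of _ 2])
  hence ne: "box 0 (pt2 (3 ^ c) 1) \<noteq> {}" by blast
  thus ?thesis
    by (simp add: is_tile_def strip_def interior_cbox closure_box)
qed

lemma prototiles_strip: "prototiles 2 strip"
proof -
  have "strip j \<noteq> (\<lambda>x. x + v) ` strip i" if "i \<noteq> j" for i j v
  proof
    assume eq: "strip j = (\<lambda>x. x + v) ` strip i"
    have mem: "x \<in> strip c \<longleftrightarrow> 0 \<le> x$1 \<and> x$1 \<le> 3 ^ c \<and> 0 \<le> x$2 \<and> x$2 \<le> 1" for x c
      by (auto simp: strip_def mem_box_cart forall_2)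
    have "0 \<in> strip j" "pt2 (3 ^ j) 0 \<in> strip j" by (simp_all add: mem)
    then obtain a b where a: "a \<in> strip i" "0 = a + v" and b: "b \<in> strip i" "pt2 (3 ^ j) 0 = b + v"
      unfolding eq by blast
    have "0 = a$1 + v$1" "3 ^ j = b$1 + v$1"
      using a(2) b(2) by (metis vector_add_component zero_index, metis vector_add_component pt2_nth(1))
    hence 1: "(3::real) ^ j \<le> 3 ^ i" using a(1) b(1) by (simp add: mem)
    have "v \<in> strip j" "pt2 (3 ^ i) 0 + v \<in> strip j"
      unfolding eq by (rule image_eqI[of _ _ 0]; simp add: mem)
        (rule image_eqI[of _ _ "pt2 (3 ^ i) 0"]; simp add: mem)
    hence "(3::real) ^ i + v$1 \<le> 3 ^ j" "0 \<le> v$1" by (simp_all add: mem)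
    hence 2: "(3::real) ^ i \<le> 3 ^ j" by linarith
    from 1 2 that show False by simp
  qed
  thus ?thesis by (simp add: prototiles_def is_tile_strip)
qed

section \<open>Substitution rules that fill rows with tiles of one type\<close>

text \<open>The parameter \<open>e\<close> encodes the order of the rows: \<open>id\<close> yields
  aba and bab, \<open>twos\<close> yields aab and bba. Both rules thereby share one
  geometry.\<close>

definition row_rule :: "(nat \<Rightarrow> nat) \<Rightarrow> nat \<Rightarrow> ltile set" where
  "row_rule e c = {((c + e r) mod 2, pt2 (3 ^ ((c + e r) mod 2) * of_nat k) (of_nat r)) | r k.
     r < 3 \<and> k < 3 ^ (c + 1 - (c + e r) mod 2)}"

lemma power_3_split:
  assumes "d < (2::nat)"
  shows "(3::'a::comm_semiring_1) ^ d * 3 ^ (c + 1 - d) = 3 ^ (c + 1)"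
  using assms by (simp flip: power_add)

lemma nat_cell:
  assumes "0 \<le> x" "x \<le> of_nat n" "n > 0"
  shows "\<exists>k<n. real k \<le> x \<and> x \<le> real k + 1"
proof (cases "x = of_nat n")
  \<comment> \<open>At the right end the floor would select cell \<open>n\<close>, which is out of
    range, so the last cell is taken.\<close>
  case True
  thus ?thesis using assms by (intro exI[of _ "n - 1"]) auto
next
  case False
  have "nat \<lfloor>x\<rfloor> < n" using assms False by (simp add: nat_less_iff floor_less_iff)
  moreover have "real (nat \<lfloor>x\<rfloor>) \<le> x \<and> x \<le> real (nat \<lfloor>x\<rfloor>) + 1"
    using assms by linarith
  ultimately show ?thesis by blast
qed

text \<open>An open cell meets no other closed cell. This serves both for disjoint interiors and for
  recognizing a tile by the midpoint of a cell.\<close>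

lemma int_cell_unique:
  assumes "w > 0" "w * real_of_int k < x" "x < w * real_of_int k + w"
    and "w * real_of_int k' \<le> x" "x \<le> w * real_of_int k' + w"
  shows "k' = k"
proof -
  have "w * real_of_int k < w * real_of_int (k' + 1)" "w * real_of_int k' < w * real_of_int (k + 1)"
    using assms by (auto simp: algebra_simps)
  hence "real_of_int k < real_of_int (k' + 1)" "real_of_int k' < real_of_int (k + 1)"
    using assms(1) by (metis mult_less_cancel_left_pos)+
  thus ?thesis by linarith
qed

lemma finite_row_rule: "finite (row_rule e c)"
proof -
  have "row_rule e c = (\<lambda>(r, k). ((c + e r) mod 2, pt2 (3 ^ ((c + e r) mod 2) * of_nat k) (of_nat r))) `
     (SIGMA r:{..<3}. {..<3 ^ (c + 1 - (c + e r) mod 2)})"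
    by (force simp: row_rule_def)
  thus ?thesis by simp
qed

text \<open>Every row order \<open>e\<close> is admissible, because the inflated width
  \<open>3 ^ (c + 1)\<close> is a multiple of both tile widths.\<close>

lemma subst_rule_row_rule: "subst_rule 2 strip 3 (row_rule e)"
proof -
  have "tessellation 2 strip (row_rule e c) ((\<lambda>x. 3 *\<^sub>R x) ` strip c)" for c
    unfolding tessellation_def
  proof (intro conjI ballI impI)
    fix p assume "p \<in> row_rule e c"
    thus "fst p < 2" by (auto simp: row_rule_def)
  next
    fix p q assume p: "p \<in> row_rule e c" and q: "q \<in> row_rule e c" and "p \<noteq> q"
    obtain r k where p': "p = ((c + e r) mod 2, pt2 (3 ^ ((c + e r) mod 2) * of_nat k) (of_nat r))"
      using p by (auto simp: row_rule_def)
    obtain r' k' where q': "q = ((c + e r') mod 2, pt2 (3 ^ ((c + e r') mod 2) * of_nat k') (of_nat r'))"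
      using q by (auto simp: row_rule_def)
    have False if x: "x \<in> interior (tile_of strip p)" "x \<in> interior (tile_of strip q)" for x
    proof -
      have "r = r'" using x by (auto simp: p' q' mem_interior_tile_of_strip)
      moreover have "int k' = int k"
        using x unfolding p' q' mem_interior_tile_of_strip calculation
        by (intro int_cell_unique[of "3 ^ ((c + e r') mod 2)" _ "x$1"]) auto
      ultimately show False using \<open>p \<noteq> q\<close> p' q' by simp
    qed
    thus "interior (tile_of strip p) \<inter> interior (tile_of strip q) = {}" by blast
  next
    have mem: "x \<in> (\<lambda>x. 3 *\<^sub>R x) ` strip c \<longleftrightarrow> 0 \<le> x$1 \<and> x$1 \<le> 3 ^ (c + 1) \<and> 0 \<le> x$2 \<and> x$2 \<le> 3" for x
    proof -
      have "x \<in> (\<lambda>x. 3 *\<^sub>R x) ` strip c \<longleftrightarrow> (1/3) *\<^sub>R x \<in> strip c"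
        by (auto intro: image_eqI[of _ _ "(1/3) *\<^sub>R x"])
      thus ?thesis by (simp add: strip_def mem_box_cart forall_2 field_simps)
    qed
    have "x \<in> \<Union> (tile_of strip ` row_rule e c) \<longleftrightarrow> x \<in> (\<lambda>x. 3 *\<^sub>R x) ` strip c" for x
    proof
      assume "x \<in> \<Union> (tile_of strip ` row_rule e c)"
      then obtain r k where r: "r < 3" and k: "k < 3 ^ (c + 1 - (c + e r) mod 2)"
        and x: "x \<in> tile_of strip ((c + e r) mod 2, pt2 (3 ^ ((c + e r) mod 2) * of_nat k) (of_nat r))"
        by (auto simp: row_rule_def)
      let ?d = "(c + e r) mod 2"
      have "k + 1 \<le> 3 ^ (c + 1 - ?d)" using k by simp
      hence "real (k + 1) \<le> 3 ^ (c + 1 - ?d)" by (metis of_nat_le_iff of_nat_power of_nat_numeral)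
      hence "3 ^ ?d * real (k + 1) \<le> 3 ^ ?d * 3 ^ (c + 1 - ?d)" by (rule mult_left_mono) simp
      also have "\<dots> = 3 ^ (c + 1)" by (rule power_3_split) simp
      finally have "3 ^ ?d * real k + 3 ^ ?d \<le> 3 ^ (c + 1)" by (simp add: algebra_simps)
      moreover have "0 \<le> 3 ^ ?d * real k" by simp
      moreover have "real r \<le> 2" using r by linarith
      ultimately show "x \<in> (\<lambda>x. 3 *\<^sub>R x) ` strip c"
        using x unfolding mem mem_tile_of_strip pt2_nth by linarith
    next
      assume "x \<in> (\<lambda>x. 3 *\<^sub>R x) ` strip c"
      hence x: "0 \<le> x$1" "x$1 \<le> 3 ^ (c + 1)" "0 \<le> x$2" "x$2 \<le> 3" unfolding mem by auto
      obtain r where r: "r < 3" "real r \<le> x$2" "x$2 \<le> real r + 1"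
        using nat_cell[of "x$2" 3] x by auto
      define d where "d = (c + e r) mod 2"
      have d: "(3::real) ^ d * 3 ^ (c + 1 - d) = 3 ^ (c + 1)" by (rule power_3_split) (simp add: d_def)
      have "x$1 / 3 ^ d \<le> real (3 ^ (c + 1 - d))"
        using x(2) unfolding d[symmetric] by (simp add: pos_divide_le_eq mult.commute)
      then obtain k where k: "k < 3 ^ (c + 1 - d)" "real k \<le> x$1 / 3 ^ d" "x$1 / 3 ^ d \<le> real k + 1"
        using nat_cell[of "x$1 / 3 ^ d" "3 ^ (c + 1 - d)"] x by auto
      have "x \<in> tile_of strip (d, pt2 (3 ^ d * of_nat k) (of_nat r))"
        using k r by (simp add: mem_tile_of_strip field_simps)
      moreover have "(d, pt2 (3 ^ d * of_nat k) (of_nat r)) \<in> row_rule e c"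
        using k(1) r(1) unfolding row_rule_def d_def by blast
      ultimately show "x \<in> \<Union> (tile_of strip ` row_rule e c)" by blast
    qed
    thus "\<Union> (tile_of strip ` row_rule e c) = (\<lambda>x. 3 *\<^sub>R x) ` strip c" by blast
  qed
  thus ?thesis by (simp add: subst_rule_def finite_row_rule)
qed

text \<open>The order \<open>e\<close> enters only through the number of rows of each type, so
  permuting rows preserves the matrix.\<close>

lemma subst_matrix_row_rule:
  assumes "i < 2"
  shows "subst_matrix (row_rule e) i j = card {r. r < 3 \<and> (j + e r) mod 2 = i} * 3 ^ (j + 1 - i)"
proof -
  let ?A = "{r. r < 3 \<and> (j + e r) mod 2 = i}"
  let ?f = "\<lambda>(r, k). pt2 (3 ^ i * real k) (real r)"
  have "{s. (i, s) \<in> row_rule e j} = ?f ` (?A \<times> {..<3 ^ (j + 1 - i)})"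
    by (force simp: row_rule_def)
  moreover have "inj_on ?f (?A \<times> {..<3 ^ (j + 1 - i)})"
    by (auto simp: inj_on_def pt_eq_iff)
  ultimately show ?thesis
    by (simp add: subst_matrix_def card_image card_cartesian_product)
qed

text \<open>Each type having a row in each inflated tile makes the matrix itself positive, so the
  exponent 1 suffices.\<close>

lemma primitive_row_rule:
  assumes "\<And>i j. i < 2 \<Longrightarrow> j < 2 \<Longrightarrow> \<exists>r<3. (j + e r) mod 2 = i"
  shows "primitive 2 (row_rule e)"
proof -
  have "subst_matrix (row_rule e) i j > 0" if "i < 2" "j < 2" for i j
    using assms[OF that] that by (auto simp: subst_matrix_row_rule card_gt_0_iff)
  hence "\<forall>i<2. \<forall>j<2. matpow 2 (subst_matrix (row_rule e)) 1 i j > 0"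
    by (auto simp: numeral_2_eq_2 less_Suc_eq)
  thus ?thesis unfolding primitive_def by blast
qed

section \<open>Tilings in the substitution spaces consist of aligned rows\<close>

text \<open>An upper half plane of rows, infinite to both sides. It is a container for all
  supertiles of type \<open>j\<close> that forgets their horizontal ends and their height.\<close>

definition half_rows :: "(nat \<Rightarrow> nat) \<Rightarrow> nat \<Rightarrow> ltile set" where
  "half_rows e j = {((j + e y) mod 2, pt2 (3 ^ ((j + e y) mod 2) * of_int k) (of_nat y)) | y k. True}"

text \<open>Tile number \<open>k\<close> of row \<open>y\<close>, where \<open>s\<close> gives the
  type of each row and \<open>v\<close> is a corner common to the alignment of all rows.\<close>

definition row_tile :: "(int \<Rightarrow> nat) \<Rightarrow> pt \<Rightarrow> int \<times> int \<Rightarrow> ltile" where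
  "row_tile s v = (\<lambda>(k, y). (s y, pt2 (3 ^ s y * of_int k) (of_int y) + v))"

lemma inj_row_tile: "inj (row_tile s v)"
  by (auto simp: inj_on_def row_tile_def pt_eq_iff)

text \<open>Row \<open>r\<close> inside an inflated row \<open>y\<close> becomes row
  \<open>3 * y + r\<close>; the hypothesis on \<open>e\<close>, additivity over ternary digits
  modulo 2, says that its type is again the one prescribed by \<open>e\<close>.\<close>

lemma subst_apply_half_rows:
  assumes e: "\<And>y r. r < 3 \<Longrightarrow> e (3 * y + r) mod 2 = (e y + e r) mod 2"
    and sub: "Q \<subseteq> half_rows e j"
  shows "subst_apply 3 (row_rule e) Q \<subseteq> half_rows e j"
proof
  fix p assume "p \<in> subst_apply 3 (row_rule e) Q"
  then obtain c t d s where p: "p = (d, 3 *\<^sub>R t + s)" and "(c, t) \<in> Q" and ds: "(d, s) \<in> row_rule e c"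
    by (auto simp: subst_apply_def)
  then obtain y k where c: "c = (j + e y) mod 2" and t: "t = pt2 (3 ^ c * of_int k) (of_nat y)"
    using sub unfolding half_rows_def by blast
  obtain r l where r: "r < 3" and d: "d = (c + e r) mod 2" and s: "s = pt2 (3 ^ d * of_nat l) (of_nat r)"
    using ds unfolding row_rule_def by blast
  have d': "d = (j + e (3 * y + r)) mod 2"
    using e[OF r, of y] unfolding d c by (metis mod_add_left_eq mod_add_right_eq add.assoc)
  have "(3::real) ^ d * 3 ^ (c + 1 - d) = 3 ^ (c + 1)" by (rule power_3_split) (simp add: d)
  hence "3 *\<^sub>R t + s = pt2 (3 ^ d * of_int (3 ^ (c + 1 - d) * k + int l)) (of_nat (3 * y + r))"
    by (simp add: t s pt_eq_iff algebra_simps)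
  with d' p show "p \<in> half_rows e j" unfolding half_rows_def by blast
qed

lemma subst_iterate_half_rows:
  assumes e: "\<And>y r. r < 3 \<Longrightarrow> e (3 * y + r) mod 2 = (e y + e r) mod 2"
    and "e 0 = 0" "j < 2"
  shows "(subst_apply 3 (row_rule e) ^^ m) {(j, 0)} \<subseteq> half_rows e j"
proof (induction m)
  case 0
  have "(j, 0) = ((j + e 0) mod 2, pt2 (3 ^ ((j + e 0) mod 2) * of_int 0) (of_nat 0))"
    using assms by (simp add: pt_eq_iff)
  hence "(j, 0) \<in> half_rows e j" unfolding half_rows_def by blast
  thus ?case by simp
next
  case (Suc m)
  thus ?case using subst_apply_half_rows[OF e] by simp
qed

lemma mem_half_rows_iff:
  "(c, t) \<in> half_rows e j \<longleftrightarrow>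
     (\<exists>y k. c = (j + e y) mod 2 \<and> t$1 = 3 ^ c * of_int k \<and> t$2 = of_nat y)"
  by (auto simp: half_rows_def pt_eq_iff)

lemma half_int_cell:
  assumes "real_of_int a \<le> real_of_int b + 1/2" "real_of_int b + 1/2 \<le> real_of_int a + 1"
  shows "a = b"
  using assms by linarith

text \<open>A wide tile fixes the horizontal alignment of all rows, which is why type 1 is required to
  recur.\<close>
lemma row_structure:
  assumes tess: "tessellation 2 strip P UNIV"
    and loc: "\<And>Q. Q \<subseteq> P \<Longrightarrow> finite Q \<Longrightarrow> \<exists>v j. shift v Q \<subseteq> half_rows e j"
    and rec: "\<And>j z. \<exists>i\<le>N. (j + e (z + i)) mod 2 = 1"
  obtains s v where "P = range (row_tile s v)" "\<And>y. s y < 2"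
    "\<And>y n. \<exists>j z. \<forall>i<n. s (y + int i) = (j + e (z + i)) mod 2"
proof -
  have cover: "\<exists>c t. (c, t) \<in> P \<and> x \<in> tile_of strip (c, t)" for x
    using tess unfolding tessellation_def by (metis UN_E UNIV_I prod.exhaust)
  obtain b where b: "(1, b) \<in> P"
  proof -
    obtain c0 t0 where t0: "(c0, t0) \<in> P" using cover by blast
    \<comment> \<open>The test points lie at mid-height of the rows above the tile at
      \<open>t0\<close>. The tiles that cover them for \<open>i \<le> N\<close> form one finite
      patch, in which \<open>rec\<close> finds a wide tile.\<close>
    have "\<forall>i. \<exists>q\<in>P. t0 + pt2 (1/2) (real i + 1/2) \<in> tile_of strip q"
      using cover by blast
    then obtain q where q: "\<And>i. q i \<in> P" "\<And>i. t0 + pt2 (1/2) (real i + 1/2) \<in> tile_of strip (q i)"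
      by metis
    obtain v j where v: "shift v (insert (c0, t0) (q ` {..N})) \<subseteq> half_rows e j"
      using loc[of "insert (c0, t0) (q ` {..N})"] t0 q(1) by auto
    have "(c0, t0 + v) \<in> half_rows e j" using v by (auto simp: shift_def)
    then obtain y where y: "t0$2 + v$2 = of_nat y" by (auto simp: mem_half_rows_iff)
    obtain i where i: "i \<le> N" "(j + e (y + i)) mod 2 = 1" using rec by blast
    obtain c t where ct: "q i = (c, t)" by fastforce
    have "(c, t + v) \<in> half_rows e j" using v i(1) ct by (force simp: shift_def)
    then obtain y' where y': "t$2 + v$2 = of_nat y'" "c = (j + e y') mod 2"
      by (auto simp: mem_half_rows_iff)
    have "int y' = int (y + i)"
      using q(2)[of i] y y'(1) unfolding ct mem_tile_of_strip by (intro half_int_cell) auto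
    hence "c = 1" using i y' by (simp flip: of_nat_add)
    thus ?thesis using that q(1)[of i] ct by simp
  qed
  \<comment> \<open>Each tile is compared with the wide tile at \<open>b\<close> in a two-tile
    patch. The wide tile sits at a multiple of 3, hence of either width.\<close>
  have grid: "\<exists>k y. t$1 = b$1 + 3 ^ c * of_int k \<and> t$2 = b$2 + of_int y" if ct: "(c, t) \<in> P" for c t
  proof -
    obtain v j where v: "shift v {(1, b), (c, t)} \<subseteq> half_rows e j"
      using loc[of "{(1, b), (c, t)}"] ct b by auto
    hence "(1, b + v) \<in> half_rows e j" "(c, t + v) \<in> half_rows e j" by (auto simp: shift_def)
    then obtain k y k' y' where *: "b$1 + v$1 = 3 * of_int k" "b$2 + v$2 = of_nat y"
        "t$1 + v$1 = 3 ^ c * of_int k'" "t$2 + v$2 = of_nat y'" and c: "c < 2"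
      by (auto simp: mem_half_rows_iff)
    have "(3::real) ^ c * 3 ^ (1 - c) = 3" using power_3_split[OF c, of 0] by simp
    hence "t$1 = b$1 + 3 ^ c * of_int (k' - 3 ^ (1 - c) * k)"
      using * by (simp add: algebra_simps)
    moreover have "t$2 = b$2 + of_int (int y' - int y)" using * by simp
    ultimately show ?thesis by blast
  qed
  \<comment> \<open>In a half plane of rows the type is a function of the height.\<close>
  have same_row: "c = d" if tu: "(c, t) \<in> P" "(d, u) \<in> P" "t$2 = u$2" for c d t u
  proof -
    obtain v j where v: "shift v {(c, t), (d, u)} \<subseteq> half_rows e j"
      using loc[of "{(c, t), (d, u)}"] tu by auto
    hence "(c, t + v) \<in> half_rows e j" "(d, u + v) \<in> half_rows e j" by (auto simp: shift_def)
    thus ?thesis using tu(3) by (auto simp: mem_half_rows_iff)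
  qed
  have row_ne: "\<exists>c t. (c, t) \<in> P \<and> t$2 = b$2 + of_int y \<and> t$1 \<le> x \<and> x \<le> t$1 + 3 ^ c" for x y
  proof -
    obtain c t where ct: "(c, t) \<in> P" "pt2 x (b$2 + of_int y + 1/2) \<in> tile_of strip (c, t)"
      using cover by blast
    obtain y' where y': "t$2 = b$2 + of_int y'" using grid[OF ct(1)] by blast
    have "y' = y" using ct(2) y' by (intro half_int_cell) (auto simp: mem_tile_of_strip)
    thus ?thesis using ct y' by (auto simp: mem_tile_of_strip)
  qed
  have "\<forall>y. \<exists>c. \<exists>t. (c, t) \<in> P \<and> t$2 = b$2 + of_int y" using row_ne by blast
  then obtain s where s: "\<And>y. \<exists>t. (s y, t) \<in> P \<and> t$2 = b$2 + of_int y" by metis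
  have s2: "s y < 2" for y using s[of y] tess unfolding tessellation_def by fastforce
  have P1: "(s y, pt2 (3 ^ s y * of_int k) (of_int y) + b) \<in> P" for k y
  proof -
    \<comment> \<open>The midpoint of the cell that tile \<open>k\<close> should occupy: a covering
      tile on the grid can only be that one.\<close>
    let ?x = "b$1 + 3 ^ s y * (of_int k + 1/2)"
    obtain c t where ct: "(c, t) \<in> P" "t$2 = b$2 + of_int y" "t$1 \<le> ?x" "?x \<le> t$1 + 3 ^ c"
      using row_ne by blast
    have c: "c = s y" using s[of y] same_row ct by metis
    obtain k' where k': "t$1 = b$1 + 3 ^ c * of_int k'" using grid[OF ct(1)] by blast
    have "k' = k"
      by (rule int_cell_unique[of "3 ^ c" _ "3 ^ s y * (of_int k + 1/2)"])
         (use ct k' c in \<open>auto simp: algebra_simps\<close>)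
    hence "t = pt2 (3 ^ s y * of_int k) (of_int y) + b" using ct k' c by (simp add: pt_eq_iff)
    thus ?thesis using ct c by simp
  qed
  have P2: "p \<in> range (row_tile s b)" if pP: "p \<in> P" for p
  proof -
    obtain c t where p: "p = (c, t)" by fastforce
    obtain k y where ky: "t$1 = b$1 + 3 ^ c * of_int k" "t$2 = b$2 + of_int y" using grid pP p by blast
    have "c = s y" using s[of y] same_row pP p ky(2) by metis
    hence "p = row_tile s b (k, y)" using ky p by (simp add: row_tile_def pt_eq_iff)
    thus ?thesis by blast
  qed
  have "\<exists>j z. \<forall>i<n. s (y + int i) = (j + e (z + i)) mod 2" for y n
  proof (cases "n = 0")
    case False
    \<comment> \<open>One tile from each of the \<open>n\<close> rows: placing them in a single
      patch yields one \<open>j\<close> and one shift for the whole window.\<close>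
    let ?q = "\<lambda>i::nat. (s (y + int i), pt2 (3 ^ s (y + int i) * of_int 0) (of_int (y + int i)) + b)"
    have "?q ` {..<n} \<subseteq> P" using P1 by blast
    then obtain v j where v: "shift v (?q ` {..<n}) \<subseteq> half_rows e j" using loc by blast
    have *: "\<exists>z. s (y + int i) = (j + e z) mod 2 \<and> of_int (y + int i) + b$2 + v$2 = of_nat z"
      if "i < n" for i
    proof -
      have "(s (y + int i), snd (?q i) + v) \<in> half_rows e j" using v that by (force simp: shift_def)
      thus ?thesis by (auto simp: mem_half_rows_iff)
    qed
    obtain z where z: "of_int y + b$2 + v$2 = of_nat z" using *[of 0] False by auto
    have "s (y + int i) = (j + e (z + i)) mod 2" if "i < n" for i
    proof -
      obtain z' where z': "s (y + int i) = (j + e z') mod 2" "of_int (y + int i) + b$2 + v$2 = of_nat z'"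
        using * \<open>i < n\<close> by blast
      have "real z' = real (z + i)" using z z'(2) by simp
      hence "z' = z + i" by (simp only: of_nat_eq_iff)
      thus ?thesis using z' by simp
    qed
    thus ?thesis by blast
  qed simp
  moreover have "P = range (row_tile s b)"
    using P1 P2 by (auto simp: row_tile_def)
  ultimately show ?thesis using that s2 by blast
qed


lemma tiling_space_rows:
  assumes e: "\<And>y r. r < 3 \<Longrightarrow> e (3 * y + r) mod 2 = (e y + e r) mod 2" "e 0 = 0"
    and rec: "\<And>j z. \<exists>i\<le>N. (j + e (z + i)) mod 2 = 1"
    and P: "P \<in> tiling_space 2 strip 3 (row_rule e)"
  obtains s v where "P = range (row_tile s v)" "\<And>y. s y < 2"
    "\<And>y n. \<exists>j z. \<forall>i<n. s (y + int i) = (j + e (z + i)) mod 2"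
proof -
  have loc: "\<exists>v j. shift v Q \<subseteq> half_rows e j" if Q: "Q \<subseteq> P" "finite Q" for Q
  proof -
    obtain m j v where "j < 2" "shift v Q \<subseteq> (subst_apply 3 (row_rule e) ^^ m) {(j, 0)}"
      using P Q unfolding tiling_space_def by blast
    with subst_iterate_half_rows[OF e, where j = j and m = m] show ?thesis by blast
  qed
  have tess: "tessellation 2 strip P UNIV" using P by (simp add: tiling_space_def)
  show ?thesis
  proof (rule row_structure[OF tess loc rec])
    fix s v
    assume "P = range (row_tile s v)" "\<And>y. s y < 2"
      and "\<And>y n. \<exists>j z. \<forall>i<n. s (y + int i) = (j + e (z + i)) mod 2"
    thus ?thesis by (rule that)
  qed
qed

section \<open>Bounded displacement equivalence\<close>

text \<open>A common index set \<open>I\<close> allows both point sets to be compared tile by tile;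
  the bijection runs from \<open>L\<close> back to \<open>I\<close> and on to the scaled
  \<open>M\<close>.\<close>

lemma bd_equivI:
  assumes "bij_betw A I L" "bij_betw B I ((\<lambda>x. \<alpha> *\<^sub>R x) ` M)" "\<alpha> > 0"
    and "\<And>i. i \<in> I \<Longrightarrow> norm (A i - B i) \<le> C"
  shows "bd_equiv L M"
proof -
  have "bij_betw (B \<circ> inv_into I A) L ((\<lambda>x. \<alpha> *\<^sub>R x) ` M)"
    using assms by (blast intro: bij_betw_trans bij_betw_inv_into)
  moreover have "norm (x - (B \<circ> inv_into I A) x) \<le> C" if "x \<in> L" for x
  proof -
    have "inv_into I A x \<in> I" "A (inv_into I A x) = x"
      using assms(1) that by (auto simp: bij_betw_def inv_into_into f_inv_into_f)
    thus ?thesis using assms(4)[of "inv_into I A x"] by simp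
  qed
  ultimately show ?thesis using assms(3) unfolding bd_equiv_def by blast
qed

text \<open>Used to carry a lattice from one Delone set to an equivalent one. Both displacements
  start at the same point of \<open>L\<close>; dividing by \<open>\<alpha>\<close> undoes the
  scaling of \<open>L'\<close> and leaves the factor \<open>\<beta> / \<alpha>\<close> on
  \<open>M\<close>.\<close>

lemma bd_equiv_euclidean:
  assumes "bd_equiv L L'" "bd_equiv L M"
  shows "bd_equiv L' M"
proof -
  obtain \<alpha> \<phi> C where \<phi>: "\<alpha> > 0" "bij_betw \<phi> L ((\<lambda>x. \<alpha> *\<^sub>R x) ` L')" "\<And>x. x \<in> L \<Longrightarrow> norm (x - \<phi> x) \<le> C"
    using assms(1) unfolding bd_equiv_def by blast
  obtain \<beta> \<theta> D where \<theta>: "\<beta> > 0" "bij_betw \<theta> L ((\<lambda>x. \<beta> *\<^sub>R x) ` M)" "\<And>x. x \<in> L \<Longrightarrow> norm (x - \<theta> x) \<le> D"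
    using assms(2) unfolding bd_equiv_def by blast
  have scale: "bij_betw (\<lambda>x. (1 / \<alpha>) *\<^sub>R x) X ((\<lambda>x. (1 / \<alpha>) *\<^sub>R x) ` X)" for X :: "pt set"
    using \<phi>(1) by (auto simp: bij_betw_def inj_on_def)
  have "bij_betw (\<lambda>x. (1 / \<alpha>) *\<^sub>R \<phi> x) L L'"
    using bij_betw_trans[OF \<phi>(2) scale] \<phi>(1) by (simp add: image_image o_def)
  moreover have "bij_betw (\<lambda>x. (1 / \<alpha>) *\<^sub>R \<theta> x) L ((\<lambda>x. (\<beta> / \<alpha>) *\<^sub>R x) ` M)"
    using bij_betw_trans[OF \<theta>(2) scale] by (simp add: image_image o_def)
  moreover have "norm ((1 / \<alpha>) *\<^sub>R \<phi> x - (1 / \<alpha>) *\<^sub>R \<theta> x) \<le> (C + D) / \<alpha>" if "x \<in> L" for x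
  proof -
    have "norm (\<phi> x - \<theta> x) \<le> C + D"
      using norm_triangle_ineq4[of "x - \<theta> x" "x - \<phi> x"] \<phi>(3)[OF that] \<theta>(3)[OF that] by simp
    moreover have "norm ((1 / \<alpha>) *\<^sub>R \<phi> x - (1 / \<alpha>) *\<^sub>R \<theta> x) = norm (\<phi> x - \<theta> x) / \<alpha>"
      using \<phi>(1) by (simp flip: scaleR_diff_right)
    ultimately show ?thesis using \<phi>(1) by (simp add: divide_right_mono)
  qed
  moreover have "\<beta> / \<alpha> > 0" using \<phi>(1) \<theta>(1) by simp
  ultimately show ?thesis by (blast intro: bd_equivI)
qed

section \<open>Periods of row tilings and their associated point sets\<close>

lemma shift_row_tiles: "shift u (range (row_tile s v)) = range (row_tile s (v + u))"
  by (auto simp: shift_def row_tile_def image_image add.assoc split_beta)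

text \<open>Width 3 holds three narrow tiles or one wide tile, so it is a horizontal period of every
  row.\<close>

lemma row_tile_width:
  assumes "s y < 2"
  shows "row_tile s (v + pt2 3 0) (k, y) = row_tile s v (k + 3 ^ (1 - s y), y)"
  using power_3_split[OF assms, of 0, where 'a = real]
  by (simp add: row_tile_def pt_eq_iff distrib_left)

lemma periodic_rows:
  assumes s2: "\<And>y. s y < 2" and per: "\<And>y. s (y + 2) = s y"
  shows "periodic_tiling (range (row_tile s v))"
  unfolding periodic_tiling_def shift_row_tiles
proof (intro exI conjI)
  show "lin_indep2 (pt2 3 0) (pt2 0 2)" by (simp add: lin_indep2_def)
  have "row_tile s v (k, y) \<in> range (row_tile s (v + pt2 3 0))" for k y
    using row_tile_width[of s y v "k - 3 ^ (1 - s y)"] s2 by (metis diff_add_cancel rangeI)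
  thus "range (row_tile s (v + pt2 3 0)) = range (row_tile s v)"
    by (auto simp: row_tile_width s2)
  have *: "row_tile s (v + pt2 0 2) (k, y) = row_tile s v (k, y + 2)" for k y
    by (simp add: row_tile_def pt_eq_iff per)
  have "row_tile s v (k, y) \<in> range (row_tile s (v + pt2 0 2))" for k y
    using *[of k "y - 2"] by (metis diff_add_cancel rangeI)
  thus "range (row_tile s (v + pt2 0 2)) = range (row_tile s v)"
    by (auto simp: *)
qed

lemma norm_diff_tile_le:
  assumes "x \<in> tile_of strip (c, t)" "c < 2"
  shows "norm (x - t) \<le> 4"
proof -
  have "(3::real) ^ c \<le> 3" using assms(2) by (auto simp: numeral_2_eq_2 less_Suc_eq)
  hence "\<bar>(x - t)$1\<bar> + \<bar>(x - t)$2\<bar> \<le> 4"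
    using assms(1) by (auto simp: mem_tile_of_strip)
  thus ?thesis using norm_pt_le[of "x - t"] by linarith
qed

text \<open>Replaces an arbitrary choice of points by the lower left corners of the tiles, at a cost
  of 4, the width 3 plus the height 1 of the wide tile.\<close>

lemma associated_rows:
  assumes "associated strip (range (row_tile s v)) L" "\<And>y. s y < 2"
  obtains A where "bij_betw A UNIV L"
    "\<And>k y. norm (A (k, y) - (pt2 (3 ^ s y * of_int k) (of_int y) + v)) \<le> 4"
proof -
  obtain f where f: "\<And>p. p \<in> range (row_tile s v) \<Longrightarrow> f p \<in> tile_of strip p"
      "inj_on f (range (row_tile s v))" "L = f ` range (row_tile s v)"
    using assms(1) unfolding associated_def by blast
  have "bij_betw (f \<circ> row_tile s v) UNIV L"
    using f(2,3) inj_row_tile by (auto simp: bij_betw_def intro: comp_inj_on)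
  moreover have "norm ((f \<circ> row_tile s v) (k, y) - (pt2 (3 ^ s y * of_int k) (of_int y) + v)) \<le> 4" for k y
    using f(1)[OF rangeI, of "(k, y)"] assms(2)[of y]
    by (intro norm_diff_tile_le) (simp_all add: row_tile_def)
  ultimately show ?thesis using that by blast
qed

section \<open>Alternating rows are equivalent to a lattice\<close>

text \<open>Each pair of rows is merged into one sequence: \<open>k + k div 3\<close> enumerates the
  integers that are not 3 modulo 4 for the narrow row, and \<open>4 * k + 3\<close> the remaining
  ones for the wide row.\<close>

lemma bij_alternating_rows:
  fixes s :: "int \<Rightarrow> nat"
  assumes alt: "\<And>y. s y + s (y + 1) = 1"
  shows "bij (\<lambda>(k::int, y::int). (if s y = 0 then k + k div 3 else 4 * k + 3, y div 2))" (is "bij ?g")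
proof (rule bijI)
  have y_eq: "y = y'" if "y div 2 = y' div 2" "s y = s y'" for y y'
  proof (rule ccontr)
    assume "y \<noteq> y'"
    hence "y' = y + 1 \<or> y = y' + 1" using that(1) by presburger
    hence "s y + s y = 1" using alt[of y] alt[of y'] that(2) by auto
    thus False by presburger
  qed
  have ne: "k + k div 3 \<noteq> 4 * k' + 3" for k k' :: int by presburger
  have k_eq: "k = k'" if "k + k div 3 = k' + k' div 3" for k k' :: int
    using that zdiv_mono1[of k k' 3] zdiv_mono1[of k' k 3] by linarith
  show "inj ?g"
  proof (rule injI, clarify)
    fix k y k' y' :: int
    assume a: "(if s y = 0 then k + k div 3 else 4 * k + 3) = (if s y' = 0 then k' + k' div 3 else 4 * k' + 3)"
      and b: "y div 2 = y' div 2"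
    have "s y \<le> 1" "s y' \<le> 1" using alt[of y] alt[of y'] by linarith+
    hence "s y = s y'" "k = k'"
      using a ne[of k k'] ne[of k' k] k_eq[of k k'] by (auto split: if_splits)
    with y_eq b show "k = k' \<and> y = y'" by blast
  qed
  have g: "\<exists>k y. ?g (k, y) = (a, b)" for a b
  proof -
    have y: "\<exists>y. y div 2 = b \<and> s y = c" if "c < 2" for c
    proof -
      have "s (2 * b) = c \<or> s (2 * b + 1) = c" using alt[of "2 * b"] that by linarith
      thus ?thesis
      proof
        assume "s (2 * b) = c" thus ?thesis by (intro exI[of _ "2 * b"]) simp
      next
        assume "s (2 * b + 1) = c" thus ?thesis by (intro exI[of _ "2 * b + 1"]) simp
      qed
    qed
    show ?thesis
    proof (cases "a mod 4 = 3")
      case True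
      obtain y where "y div 2 = b" "s y = 1" using y[of 1] by auto
      moreover have "4 * (a div 4) + 3 = a" using True by presburger
      ultimately show ?thesis by (intro exI[of _ "a div 4"] exI[of _ y]) simp
    next
      case False
      obtain y where "y div 2 = b" "s y = 0" using y[of 0] by auto
      \<comment> \<open>The inverse of \<open>k + k div 3\<close> subtracts the number of skipped
        values.\<close>
      moreover have "(a - a div 4) + (a - a div 4) div 3 = a"
      proof -
        have "a - a div 4 = a mod 4 + a div 4 * 3" by presburger
        moreover have "0 \<le> a mod 4" "a mod 4 < 3" using False by presburger+
        ultimately have "(a - a div 4) div 3 = a div 4"
          by (metis add.commute add.left_neutral div_mult_self2 div_pos_pos_trivial mult.commute zero_neq_numeral)
        thus ?thesis by simp
      qed
      ultimately show ?thesis by (intro exI[of _ "a - a div 4"] exI[of _ y]) simp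
    qed
  qed
  have "p \<in> range ?g" for p
  proof -
    obtain k y where "?g (k, y) = (fst p, snd p)" using g by blast
    thus ?thesis unfolding prod.collapse by (rule range_eqI[OF sym])
  qed
  thus "surj ?g" by blast
qed

text \<open>Two consecutive rows of the periodic tiling carry four tiles per width 3, hence the
  lattice generated by (3/4, 0) and (0, 2).\<close>
lemma alternating_rows_bd_lattice:
  assumes alt: "\<And>y. s y + s (y + 1) = (1::nat)"
    and L: "associated strip (range (row_tile s v)) L"
  shows "\<exists>La. lattice2 La \<and> bd_equiv L La"
proof -
  let ?La = "{of_int a *\<^sub>R pt2 (3/4) 0 + of_int b *\<^sub>R pt2 0 2 | a b. True}"
  let ?h = "\<lambda>(a::int, b::int). of_int a *\<^sub>R pt2 (3/4) 0 + of_int b *\<^sub>R pt2 0 2"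
  let ?g = "\<lambda>(k::int, y::int). (if s y = 0 then k + k div 3 else 4 * k + 3, y div 2)"
  have s2: "s y < 2" for y using alt[of y] by linarith
  obtain A where A: "bij_betw A UNIV L"
    "\<And>k y. norm (A (k, y) - (pt2 (3 ^ s y * of_int k) (of_int y) + v)) \<le> 4"
    using associated_rows[OF L s2] by blast
  have "range ?h = ?La" by (auto simp only: image_iff split_paired_Ex Bex_def prod.case)
  hence h: "bij_betw ?h UNIV ?La"
    by (auto simp: bij_betw_def inj_on_def pt_eq_iff)
  have g: "bij ?g" by (rule bij_alternating_rows) (rule alt)
  have B: "bij_betw (?h \<circ> ?g) UNIV ((\<lambda>x. 1 *\<^sub>R x) ` ?La)"
    using bij_betw_trans[OF g h] by simp
  \<comment> \<open>The summand 4 accounts for the choice of points in tiles, and 5 for the distance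
    from corner to lattice point, at most 4 horizontally and 1 vertically.\<close>
  have "norm (A i - (?h \<circ> ?g) i) \<le> 4 + norm v + 5" if "i \<in> UNIV" for i
  proof -
    obtain k y where i: "i = (k, y)" by fastforce
    define d where "d = pt2 (3 ^ s y * of_int k) (of_int y) - (?h \<circ> ?g) i"
    have "\<bar>d$2\<bar> \<le> 1"
    proof -
      have "y = 2 * (y div 2) + y mod 2" by simp
      hence "real_of_int y = 2 * real_of_int (y div 2) + real_of_int (y mod 2)" by linarith
      moreover have "0 \<le> y mod 2" "y mod 2 \<le> 1" by presburger+
      ultimately show ?thesis by (simp add: d_def i)
    qed
    moreover have "\<bar>d$1\<bar> \<le> 4"
    proof (cases "s y = 0")
      case True
      have "k = 3 * (k div 3) + k mod 3" by simp
      hence "real_of_int k = 3 * real_of_int (k div 3) + real_of_int (k mod 3)" by linarith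
      moreover have "0 \<le> k mod 3" "k mod 3 \<le> 2" by presburger+
      ultimately show ?thesis using True by (simp add: d_def i field_simps)
    next
      case False
      hence "s y = 1" using s2[of y] by linarith
      thus ?thesis by (simp add: d_def i field_simps)
    qed
    ultimately have "norm d \<le> 5" using norm_pt_le[of d] by linarith
    moreover have split: "A i - (?h \<circ> ?g) i = (A i - (pt2 (3 ^ s y * of_int k) (of_int y) + v)) + (v + d)"
      by (simp add: d_def)
    have "norm (A i - (?h \<circ> ?g) i) \<le> 4 + norm (v + d)"
      unfolding split by (rule norm_triangle_mono[OF A(2)[of k y, folded i] order_refl])
    ultimately show ?thesis using norm_triangle_ineq[of v d] by linarith
  qed
  hence "bd_equiv L ?La" by (rule bd_equivI[OF A(1) B zero_less_one])
  moreover have "lattice2 ?La"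
    unfolding lattice2_def by (intro exI[of _ "pt2 (3/4) 0"] exI[of _ "pt2 0 2"]) (simp add: lin_indep2_def)
  ultimately show ?thesis by blast
qed

section \<open>Almost translations of sets equivalent to a lattice\<close>

lemma lattice_near:
  assumes "lattice2 La"
  obtains D where "\<And>w. \<exists>l\<in>La. norm (w - l) \<le> D"
    and "\<And>x y. x \<in> La \<Longrightarrow> y \<in> La \<Longrightarrow> x + y \<in> La"
proof -
  obtain u v where uv: "lin_indep2 u v" and La: "La = {of_int a *\<^sub>R u + of_int b *\<^sub>R v | a b. True}"
    using assms unfolding lattice2_def by blast
  define d where "d = u$1 * v$2 - u$2 * v$1"
  have d: "d \<noteq> 0" using uv by (simp add: lin_indep2_def d_def)
  have "\<exists>l\<in>La. norm (w - l) \<le> norm u + norm v" for w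
  proof -
    \<comment> \<open>Coordinates of \<open>w\<close> in the basis \<open>u\<close>,
      \<open>v\<close> by Cramer's rule; rounding them down gives the lattice point.\<close>
    define p q where "p = (w$1 * v$2 - w$2 * v$1) / d" and "q = (u$1 * w$2 - u$2 * w$1) / d"
    have "d *\<^sub>R w = (d * p) *\<^sub>R u + (d * q) *\<^sub>R v"
      using d by (simp add: pt_eq_iff p_def q_def) (simp add: d_def algebra_simps)
    hence "d *\<^sub>R w = d *\<^sub>R (p *\<^sub>R u + q *\<^sub>R v)" by (simp add: scaleR_add_right)
    hence w: "w = p *\<^sub>R u + q *\<^sub>R v" using d by simp
    define l where "l = of_int \<lfloor>p\<rfloor> *\<^sub>R u + of_int \<lfloor>q\<rfloor> *\<^sub>R v"
    have frac: "norm ((x - of_int \<lfloor>x\<rfloor>) *\<^sub>R z) \<le> norm z" for x and z :: pt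
    proof -
      have "\<bar>x - of_int \<lfloor>x\<rfloor>\<bar> \<le> 1" by linarith
      thus ?thesis by (simp add: mult_left_le_one_le)
    qed
    have "w - l = (p - of_int \<lfloor>p\<rfloor>) *\<^sub>R u + (q - of_int \<lfloor>q\<rfloor>) *\<^sub>R v"
      by (simp add: w l_def algebra_simps)
    hence "norm (w - l) \<le> norm u + norm v"
      using norm_triangle_mono[OF frac frac] by simp
    moreover have "l \<in> La" unfolding La l_def by blast
    ultimately show ?thesis by blast
  qed
  moreover have "x + y \<in> La" if xy: "x \<in> La" "y \<in> La" for x y
  proof -
    obtain a b a' b' where "x = of_int a *\<^sub>R u + of_int b *\<^sub>R v" "y = of_int a' *\<^sub>R u + of_int b' *\<^sub>R v"
      using xy unfolding La by blast
    hence "x + y = of_int (a + a') *\<^sub>R u + of_int (b + b') *\<^sub>R v"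
      by (simp add: algebra_simps)
    thus ?thesis unfolding La by blast
  qed
  ultimately show ?thesis using that by blast
qed

text \<open>The almost translations are the lattice translations conjugated by the bounded displacement
  bijection.\<close>
lemma bd_lattice_almost_translation:
  assumes "bd_equiv L La" "lattice2 La"
  obtains E where "\<And>w. \<exists>\<psi>. inj_on \<psi> L \<and> \<psi> ` L \<subseteq> L \<and> (\<forall>x\<in>L. norm (\<psi> x - x - w) \<le> E)"
proof -
  obtain \<alpha> \<phi> C where \<phi>: "\<alpha> > 0" "bij_betw \<phi> L ((\<lambda>x. \<alpha> *\<^sub>R x) ` La)" "\<And>x. x \<in> L \<Longrightarrow> norm (x - \<phi> x) \<le> C"
    using assms(1) unfolding bd_equiv_def by blast
  obtain D where D: "\<And>w. \<exists>l\<in>La. norm (w - l) \<le> D"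
    "\<And>x y. x \<in> La \<Longrightarrow> y \<in> La \<Longrightarrow> x + y \<in> La"
    by (rule lattice_near[OF assms(2)]) blast
  \<comment> \<open>The bound collects one displacement on the way to the lattice, the rounding of
    \<open>w\<close> to the scaled lattice, and one displacement on the way back.\<close>
  have "\<exists>\<psi>. inj_on \<psi> L \<and> \<psi> ` L \<subseteq> L \<and> (\<forall>x\<in>L. norm (\<psi> x - x - w) \<le> C + \<alpha> * D + C)" for w
  proof -
    obtain l where l: "l \<in> La" "norm ((1 / \<alpha>) *\<^sub>R w - l) \<le> D" using D(1) by blast
    have "w - \<alpha> *\<^sub>R l = \<alpha> *\<^sub>R ((1 / \<alpha>) *\<^sub>R w - l)" using \<phi>(1) by (simp add: scaleR_diff_right)
    hence wl: "norm (\<alpha> *\<^sub>R l - w) \<le> \<alpha> * D"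
      using l(2) \<phi>(1) by (simp add: norm_minus_commute)
    define \<psi> where "\<psi> x = inv_into L \<phi> (\<phi> x + \<alpha> *\<^sub>R l)" for x
    have img: "\<phi> ` L = (\<lambda>x. \<alpha> *\<^sub>R x) ` La" using \<phi>(2) by (simp add: bij_betw_def)
    have "\<phi> x + \<alpha> *\<^sub>R l \<in> \<phi> ` L" if x: "x \<in> L" for x
    proof -
      obtain y where "y \<in> La" "\<phi> x = \<alpha> *\<^sub>R y" using img x by blast
      thus ?thesis unfolding img using D(2)[OF _ l(1)] by (auto simp flip: scaleR_add_right)
    qed
    hence \<psi>: "\<psi> x \<in> L" "\<phi> (\<psi> x) = \<phi> x + \<alpha> *\<^sub>R l" if "x \<in> L" for x
      using that by (simp_all add: \<psi>_def inv_into_into f_inv_into_f)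
    have "inj_on \<psi> L"
    proof (rule inj_onI)
      fix x y assume xy: "x \<in> L" "y \<in> L" "\<psi> x = \<psi> y"
      hence "\<phi> x = \<phi> y" using \<psi>(2)[of x] \<psi>(2)[of y] by simp
      thus "x = y" using \<phi>(2) xy by (auto simp: bij_betw_def inj_on_def)
    qed
    moreover have "norm (\<psi> x - x - w) \<le> C + \<alpha> * D + C" if x: "x \<in> L" for x
    proof -
      have "\<psi> x - x - w = (\<psi> x - \<phi> (\<psi> x)) + (\<alpha> *\<^sub>R l - w) + (\<phi> x - x)"
        using \<psi>(2)[OF x] by simp
      moreover have "norm (\<psi> x - \<phi> (\<psi> x)) \<le> C" "norm (\<phi> x - x) \<le> C"
        using \<phi>(3) \<psi>(1) x by (auto simp: norm_minus_commute)
      ultimately show ?thesis using wl by (metis norm_triangle_mono)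
    qed
    ultimately show ?thesis using \<psi>(1) by blast
  qed
  thus ?thesis using that by blast
qed

text \<open>Moves the almost translation by \<open>(0, d)\<close> from points to tile indices and
  makes its error an integer, so that tiles can be counted.\<close>

lemma rows_almost_translation:
  assumes s2: "\<And>y. s y < 2" and L: "associated strip (range (row_tile s v)) L"
    and "bd_equiv L La" "lattice2 La"
  obtains E where "E \<ge> 0" "\<And>d. \<exists>\<Psi>. inj \<Psi> \<and> (\<forall>k y k' y'. \<Psi> (k, y) = (k', y') \<longrightarrow>
      \<bar>3 ^ s y' * k' - 3 ^ s y * k\<bar> \<le> E \<and> \<bar>y' - y - d\<bar> \<le> (E :: int))"
proof -
  obtain A where A: "bij_betw A UNIV L"
    "\<And>k y. norm (A (k, y) - (pt2 (3 ^ s y * of_int k) (of_int y) + v)) \<le> 4"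
    using associated_rows[OF L s2] by blast
  obtain C where C: "\<And>w. \<exists>\<psi>. inj_on \<psi> L \<and> \<psi> ` L \<subseteq> L \<and> (\<forall>x\<in>L. norm (\<psi> x - x - w) \<le> C)"
    by (rule bd_lattice_almost_translation[OF assms(3,4)]) blast
  \<comment> \<open>The 8 pays for passing from points to corners in the source and in the target
    tile; absolute value and ceiling turn \<open>C\<close> into a nonnegative integer.\<close>
  have "\<exists>\<Psi>. inj \<Psi> \<and> (\<forall>k y k' y'. \<Psi> (k, y) = (k', y') \<longrightarrow>
      \<bar>3 ^ s y' * k' - 3 ^ s y * k\<bar> \<le> \<lceil>\<bar>C\<bar>\<rceil> + 8 \<and> \<bar>y' - y - d\<bar> \<le> \<lceil>\<bar>C\<bar>\<rceil> + 8)" for d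
  proof -
    obtain \<psi> where \<psi>: "inj_on \<psi> L" "\<psi> ` L \<subseteq> L" "\<And>x. x \<in> L \<Longrightarrow> norm (\<psi> x - x - pt2 0 (of_int d)) \<le> C"
      using C[of "pt2 0 (of_int d)"] by blast
    define \<Psi> where "\<Psi> = inv A \<circ> (\<psi> \<circ> A)"
    have AL: "A i \<in> L" for i using A(1) by (auto simp: bij_betw_def)
    have A\<Psi>: "A (\<Psi> i) = \<psi> (A i)" for i
      using A(1) AL \<psi>(2) by (auto simp: \<Psi>_def bij_betw_def intro!: f_inv_into_f)
    have "inj \<Psi>"
    proof (rule injI)
      fix i j assume "\<Psi> i = \<Psi> j"
      hence "\<psi> (A i) = \<psi> (A j)" by (metis A\<Psi>)
      hence "A i = A j" using \<psi>(1) AL by (auto simp: inj_on_def)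
      thus "i = j" using bij_betw_imp_inj_on[OF A(1)] by (simp add: inj_eq)
    qed
    moreover have "\<bar>3 ^ s y' * k' - 3 ^ s y * k\<bar> \<le> \<lceil>\<bar>C\<bar>\<rceil> + 8 \<and> \<bar>y' - y - d\<bar> \<le> \<lceil>\<bar>C\<bar>\<rceil> + 8"
      if \<Psi>: "\<Psi> (k, y) = (k', y')" for k y k' y'
    proof -
      let ?p = "pt2 (3 ^ s y * of_int k) (of_int y)" and ?p' = "pt2 (3 ^ s y' * of_int k') (of_int y')"
      let ?D = "?p' - ?p - pt2 0 (of_int d)"
      have "?D = (?p' + v - A (k', y')) + (\<psi> (A (k, y)) - A (k, y) - pt2 0 (of_int d)) + (A (k, y) - (?p + v))"
        using A\<Psi>[of "(k, y)"] \<Psi> by simp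
      moreover have "norm (?p' + v - A (k', y')) \<le> 4"
        using A(2)[of k' y'] by (simp add: norm_minus_commute)
      moreover have "norm (\<psi> (A (k, y)) - A (k, y) - pt2 0 (of_int d)) \<le> C" using \<psi>(3) AL by blast
      ultimately have "norm ?D \<le> 4 + C + 4" using A(2)[of k y] by (metis norm_triangle_mono)
      hence "\<bar>?D$1\<bar> \<le> C + 8" "\<bar>?D$2\<bar> \<le> C + 8"
        using component_le_norm_cart[of ?D 1] component_le_norm_cart[of ?D 2] by linarith+
      moreover have "?D$1 = of_int (3 ^ s y' * k' - 3 ^ s y * k)" "?D$2 = of_int (y' - y - d)" by simp_all
      ultimately have "real_of_int \<bar>3 ^ s y' * k' - 3 ^ s y * k\<bar> \<le> C + 8" "real_of_int \<bar>y' - y - d\<bar> \<le> C + 8"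
        by (metis of_int_abs)+
      thus ?thesis by linarith
    qed
    ultimately show ?thesis by blast
  qed
  moreover have "\<lceil>\<bar>C\<bar>\<rceil> + 8 \<ge> 0" by linarith
  ultimately show ?thesis using that by blast
qed

section \<open>Counting tiles in a rectangle and its translate\<close>

text \<open>With margins that are multiples of 3 the ends correspond exactly to tile indices. The
  main term is \<open>n * W\<close>; the rest is the boundary of one row.\<close>

lemma card_row_bound:
  fixes W E :: int
  assumes "c < (2::nat)" "W \<ge> 0" "E \<ge> 0"
  defines "n \<equiv> 3 ^ (1 - c)"
  shows "finite {k::int. - 3 * E \<le> 3 ^ c * k \<and> 3 ^ c * k \<le> 3 * W + 3 * E}"
    and "int (card {k::int. - 3 * E \<le> 3 ^ c * k \<and> 3 ^ c * k \<le> 3 * W + 3 * E}) \<le> n * (W + 2 * E) + 1"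
proof -
  have n: "(3::int) ^ c * n = 3" using power_3_split[OF assms(1), of 0, where 'a = int] by (simp add: n_def)
  have sub: "{k::int. - 3 * E \<le> 3 ^ c * k \<and> 3 ^ c * k \<le> 3 * W + 3 * E} \<subseteq> {- n * E .. n * (W + E)}"
  proof clarify
    fix k :: int assume k: "- 3 * E \<le> 3 ^ c * k" "3 ^ c * k \<le> 3 * W + 3 * E"
    have "3 ^ c * (- n * E) = - 3 * E" "3 ^ c * (n * (W + E)) = 3 * W + 3 * E"
      using n by (metis mult.assoc mult_minus_left mult_minus_right, metis mult.assoc distrib_left)
    hence "3 ^ c * (- n * E) \<le> 3 ^ c * k" "3 ^ c * k \<le> 3 ^ c * (n * (W + E))" using k by linarith+
    moreover have "(0::int) < 3 ^ c" by simp
    ultimately show "k \<in> {- n * E .. n * (W + E)}" by (simp only: mult_le_cancel_left_pos atLeastAtMost_iff)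
  qed
  thus "finite {k::int. - 3 * E \<le> 3 ^ c * k \<and> 3 ^ c * k \<le> 3 * W + 3 * E}"
    using finite_subset by blast
  have "int (card {k::int. - 3 * E \<le> 3 ^ c * k \<and> 3 ^ c * k \<le> 3 * W + 3 * E}) \<le> int (card {- n * E .. n * (W + E)})"
    unfolding of_nat_le_iff by (rule card_mono[OF _ sub]) simp
  also have "\<dots> = n * (W + 2 * E) + 1"
    using assms(2,3) by (simp add: n_def algebra_simps)
  finally show "int (card {k::int. - 3 * E \<le> 3 ^ c * k \<and> 3 ^ c * k \<le> 3 * W + 3 * E}) \<le> n * (W + 2 * E) + 1" .
qed

text \<open>Row y contains 3 ^ (1 - s y) tiles per width 3; the sums count the tiles in a rectangle of
  width 3 W and in its vertical translate by d.\<close>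
lemma row_count_le:
  fixes W E y1 d h :: int and s :: "int \<Rightarrow> nat"
  assumes s2: "\<And>y. s y < 2" and "W \<ge> 0" "E \<ge> 0" "h \<ge> 0"
    and \<Psi>: "inj \<Psi>" "\<And>k y k' y'. \<Psi> (k, y) = (k', y') \<Longrightarrow>
      \<bar>3 ^ s y' * k' - 3 ^ s y * k\<bar> \<le> 3 * E \<and> \<bar>y' - y - d\<bar> \<le> 3 * E"
  shows "W * (\<Sum>y\<in>{y1..<y1 + h}. 3 ^ (1 - s y)) \<le>
    W * (\<Sum>y\<in>{y1 + d..<y1 + d + h}. 3 ^ (1 - s y)) + (h + 6 * E) * (6 * E + 1) + 18 * E * W"
proof -
  let ?n = "\<lambda>y. (3::int) ^ (1 - s y)"
  let ?K = "\<lambda>y. {k::int. - 3 * E \<le> 3 ^ s y * k \<and> 3 ^ s y * k \<le> 3 * W + 3 * E}"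
  let ?X = "\<lambda>y. {k::int. 0 \<le> k \<and> k < W * ?n y}"
  let ?Y1 = "{y1..<y1 + h}" and ?Y2 = "{y1 + d..<y1 + d + h}"
  let ?Z = "{y1 + d - 3 * E..<y1 + d + h + 3 * E}"
  \<comment> \<open>\<open>?S\<close> is the set of tile indices in the rectangle and
    \<open>?T\<close> those in its translate enlarged by the error of \<open>\<Psi>\<close> on every
    side. The swap reconciles pairs with the row first and the order expected by
    \<open>\<Psi>\<close>.\<close>
  let ?S = "(\<lambda>(y, k). (k, y)) ` (SIGMA y:?Y1. ?X y)" and ?T = "(\<lambda>(y, k). (k, y)) ` (SIGMA y:?Z. ?K y)"
  have n: "(3::int) ^ s y * ?n y = 3" for y
    using power_3_split[OF s2[of y], of 0, where 'a = int] by simp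
  have n3: "0 \<le> ?n y" "?n y \<le> 3" for y
    using s2[of y] by (auto simp: numeral_2_eq_2 less_Suc_eq)
  have X: "?X y = {0..<W * ?n y}" for y by auto
  have cardX: "finite (?X y)" "int (card (?X y)) = W * ?n y" for y
    unfolding X using assms(2) n3 by simp_all
  have finT: "finite ?T" using card_row_bound(1)[OF s2 assms(2,3)] by blast
  have inj_swap: "inj_on (\<lambda>(y, k). (k, y)) M" for M :: "(int \<times> int) set" by (auto simp: inj_on_def)
  have cardS: "int (card ?S) = W * (\<Sum>y\<in>?Y1. ?n y)"
  proof -
    have "card ?S = (\<Sum>y\<in>?Y1. card (?X y))"
      by (subst card_image[OF inj_swap], rule card_SigmaI) (use cardX(1) in auto)
    thus ?thesis by (simp only: of_nat_sum cardX(2) sum_distrib_left)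
  qed
  have "\<Psi> ` ?S \<subseteq> ?T"
  proof
    fix q assume "q \<in> \<Psi> ` ?S"
    then obtain k y where ky: "y1 \<le> y" "y < y1 + h" "0 \<le> k" "k < W * ?n y" "q = \<Psi> (k, y)" by auto
    obtain k' y' where q: "q = (k', y')" by fastforce
    have 1: "\<bar>3 ^ s y' * k' - 3 ^ s y * k\<bar> \<le> 3 * E" "\<bar>y' - y - d\<bar> \<le> 3 * E" using \<Psi>(2) ky(5) q by metis+
    have "3 ^ s y * k \<le> 3 ^ s y * (W * ?n y)" using ky(4) by simp
    also have "\<dots> = 3 * W" using n[of y] by (metis mult.assoc mult.commute)
    finally have "3 ^ s y * k \<le> 3 * W" .
    moreover have "0 \<le> 3 ^ s y * k" using ky(3) by simp
    ultimately have "k' \<in> ?K y'" using 1(1) by auto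
    moreover have "y' \<in> ?Z" using 1(2) ky by auto
    ultimately show "q \<in> ?T" unfolding q by (auto intro: image_eqI[of _ _ "(y', k')"])
  qed
  hence "card ?S \<le> card ?T"
    using card_inj_on_le[of \<Psi> ?S ?T] finT inj_on_subset[OF \<Psi>(1) subset_UNIV] by blast
  hence "W * (\<Sum>y\<in>?Y1. ?n y) \<le> int (card ?T)" using cardS by linarith
  also have "\<dots> = (\<Sum>y\<in>?Z. int (card (?K y)))"
    using card_row_bound(1)[OF s2 assms(2,3)] by (simp add: card_image[OF inj_swap] card_SigmaI)
  also have "\<dots> \<le> (\<Sum>y\<in>?Z. W * ?n y + (6 * E + 1))"
  proof (rule sum_mono)
    fix y
    have "int (card (?K y)) \<le> ?n y * (W + 2 * E) + 1" by (rule card_row_bound(2)[OF s2 assms(2,3)])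
    moreover have "?n y * (2 * E) \<le> 3 * (2 * E)" using n3[of y] assms(3) by (intro mult_right_mono) auto
    ultimately show "int (card (?K y)) \<le> W * ?n y + (6 * E + 1)" by (simp add: algebra_simps)
  qed
  also have "\<dots> = W * (\<Sum>y\<in>?Z. ?n y) + (h + 6 * E) * (6 * E + 1)"
    using assms(3,4) by (simp add: sum.distrib sum_distrib_left algebra_simps)
  \<comment> \<open>The enlargement adds \<open>3 * E\<close> rows above and below, each with at
    most 3 tiles per width 3.\<close>
  also have "(\<Sum>y\<in>?Z. ?n y) \<le> (\<Sum>y\<in>?Y2. ?n y) + 18 * E"
  proof -
    have "(\<Sum>y\<in>?Z. ?n y) = (\<Sum>y\<in>?Y2. ?n y) + (\<Sum>y\<in>?Z - ?Y2. ?n y)"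
      using sum.subset_diff[of ?Y2 ?Z ?n] assms(3) by auto
    moreover have "(\<Sum>y\<in>?Z - ?Y2. ?n y) \<le> int (card (?Z - ?Y2)) * 3"
      using n3 by (intro sum_bounded_above) auto
    moreover have "int (card (?Z - ?Y2)) = 6 * E"
      using assms(3,4) by (subst card_Diff_subset) auto
    ultimately show ?thesis by linarith
  qed
  hence "W * (\<Sum>y\<in>?Z. ?n y) + (h + 6 * E) * (6 * E + 1) \<le>
      W * ((\<Sum>y\<in>?Y2. ?n y) + 18 * E) + (h + 6 * E) * (6 * E + 1)"
    using assms(2) by (simp add: mult_left_mono)
  finally show ?thesis by (simp add: algebra_simps)
qed

section \<open>Ternary digits 2 and the discrepancy of row counts\<close>

fun twos :: "nat \<Rightarrow> nat" where
  "twos n = (if n = 0 then 0 else twos (n div 3) + (if n mod 3 = 2 then 1 else 0))"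

declare twos.simps [simp del]

lemma twos_0 [simp]: "twos 0 = 0"
  by (simp add: twos.simps)

lemma twos_digit:
  assumes "r < 3"
  shows "twos (3 * n + r) = twos n + (if r = 2 then 1 else 0)"
proof (cases "3 * n + r = 0")
  case False
  have "(3 * n + r) div 3 = n" "(3 * n + r) mod 3 = r" using assms by auto
  thus ?thesis using False by (subst twos.simps) simp
qed simp

lemma twos_less_3: "r < 3 \<Longrightarrow> twos r = (if r = 2 then 1 else 0)"
  using twos_digit[of r 0] by simp

text \<open>The argument is the ternary expansion of \<open>q\<close> followed by \<open>m\<close>
  digits, where leading zeros of \<open>r\<close> contribute nothing.\<close>

lemma twos_block:
  assumes "r < 3 ^ m"
  shows "twos (3 ^ m * q + r) = twos q + twos r"
  using assms
proof (induction m arbitrary: r)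
  case (Suc m)
  obtain r' d where r: "r = 3 * r' + d" "d < 3" by (metis mod_div_decomp mult.commute mod_less_divisor zero_less_numeral)
  have "r' < 3 ^ m" using Suc.prems r by simp
  have "3 ^ Suc m * q + r = 3 * (3 ^ m * q + r') + d" by (simp add: r algebra_simps)
  hence "twos (3 ^ Suc m * q + r) = twos (3 ^ m * q + r') + (if d = 2 then 1 else 0)"
    using twos_digit[OF r(2)] by metis
  moreover have "twos r = twos r' + (if d = 2 then 1 else 0)" unfolding r(1) by (rule twos_digit[OF r(2)])
  ultimately show ?case using Suc.IH[OF \<open>r' < 3 ^ m\<close>] by simp
qed simp

text \<open>The index h whose ternary digits are m ones; there the partial sums of (-1)^twos reach m,
  because a full triple of consecutive terms sums to the value of its prefix.\<close>
lemma twos_sum: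
  "\<exists>h. 2 * h + 1 = (3::nat) ^ m \<and> twos h = 0 \<and> (\<Sum>i<h. (-1) ^ twos i) = int m"
proof (induction m)
  case (Suc m)
  then obtain h where h: "2 * h + 1 = 3 ^ m" "twos h = 0" "(\<Sum>i<h. (-1) ^ twos i) = int m" by blast
  have triple: "(\<Sum>i<3 * n. (-1::int) ^ twos i) = (\<Sum>i<n. (-1) ^ twos i)" for n
  proof (induction n)
    case (Suc n)
    have Suc3: "3 * Suc n = Suc (Suc (Suc (3 * n)))" by simp
    have "twos (Suc (Suc (3 * n))) = twos n + 1" "twos (Suc (3 * n)) = twos n" "twos (3 * n) = twos n"
      using twos_digit[of 2 n] twos_digit[of 1 n] twos_digit[of 0 n] by simp_all
    thus ?case using Suc unfolding Suc3 sum.lessThan_Suc by simp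
  qed simp
  have "twos (3 * h) = 0" "twos (3 * h + 1) = 0" using twos_digit[of 0 h] twos_digit[of 1 h] h(2) by simp_all
  \<comment> \<open>Appending the digit 1 adds just the term at index \<open>3 * h\<close>, which is
    1 because \<open>twos (3 * h) = 0\<close>.\<close>
  thus ?case using h triple[of h] by (intro exI[of _ "3 * h + 1"]) simp
qed (intro exI[of _ 0], simp)

text \<open>Three consecutive blocks of length 3 ^ m starting at a multiple of 3 ^ (m + 1): the first
  and the third are complementary.\<close>
lemma row_discrepancy:
  fixes s :: "int \<Rightarrow> nat"
  assumes win: "\<And>y n. \<exists>j z. \<forall>i<n. s (y + int i) = (j + twos (z + i)) mod 2"
  shows "\<exists>y1 d h. h \<ge> 0 \<and> (\<Sum>y\<in>{y1..<y1 + h}. 3 ^ (1 - s y)) =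
    (\<Sum>y\<in>{y1 + d..<y1 + d + h}. 3 ^ (1 - s y)) + 2 * int m"
proof -
  obtain h where h: "2 * h + 1 = (3::nat) ^ m" "(\<Sum>i<h. (-1) ^ twos i) = int m" using twos_sum by blast
  \<comment> \<open>A window of twice the block length contains a full aligned block of length
    \<open>3 ^ Suc m\<close>, whatever its start \<open>z\<close>.\<close>
  obtain j z where jz: "\<And>i. i < 2 * 3 ^ Suc m \<Longrightarrow> s (0 + int i) = (j + twos (z + i)) mod 2"
    using win[where y = 0 and n = "2 * 3 ^ Suc m"] by blast
  \<comment> \<open>\<open>q\<close> indexes an aligned block beginning inside the window, and
    \<open>a r\<close> is the position in the window of its \<open>r\<close>-th third.\<close>
  define q where "q = z div 3 ^ Suc m + 1"
  define a where "a r = 3 ^ m * (3 * q + r) - z" for r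
  have zq: "z \<le> 3 ^ Suc m * q" "3 ^ Suc m * q \<le> z + 3 ^ Suc m"
  proof -
    have "z = 3 ^ Suc m * (z div 3 ^ Suc m) + z mod 3 ^ Suc m" by simp
    moreover have "z mod 3 ^ Suc m < 3 ^ Suc m" by simp
    moreover have "3 ^ Suc m * q = 3 ^ Suc m * (z div 3 ^ Suc m) + 3 ^ Suc m" by (simp add: q_def)
    ultimately show "z \<le> 3 ^ Suc m * q" "3 ^ Suc m * q \<le> z + 3 ^ Suc m" by linarith+
  qed
  have block: "(\<Sum>y\<in>{int (a r)..<int (a r) + int h}. (3::int) ^ (1 - s y)) =
      2 * int h + (-1) ^ (j + twos q + twos r) * int m" if r: "r < 3" for r
  proof -
    have "(\<Sum>y\<in>{int (a r)..<int (a r) + int h}. (3::int) ^ (1 - s y)) = (\<Sum>i<h. 3 ^ (1 - s (int (a r + i))))"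
      by (rule sum.reindex_bij_witness[of _ "\<lambda>i. int (a r + i)" "\<lambda>y. nat y - a r"]) auto
    \<comment> \<open>The counts 3 and 1 are written as 2 plus or minus 1, and the sign factors into
      a part for the block and a part for the position in it.\<close>
    also have "\<dots> = (\<Sum>i<h. 2 + (-1) ^ (j + twos q + twos r) * (-1) ^ twos i)"
    proof (rule sum.cong[OF refl])
      fix i assume "i \<in> {..<h}"
      hence i: "i < 3 ^ m" using h(1) by simp
      have "3 ^ m * (3 * q + r) = 3 ^ Suc m * q + 3 ^ m * r" by (simp add: algebra_simps)
      moreover have "3 ^ m * r + 3 ^ m \<le> 3 ^ Suc m"
      proof -
        have "3 ^ m * (r + 1) \<le> 3 ^ m * (3::nat)" using r by (intro mult_left_mono) auto
        thus ?thesis by simp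
      qed
      ultimately have ai: "z + (a r + i) = 3 ^ m * (3 * q + r) + i" "a r + i < 2 * 3 ^ Suc m"
        using zq i unfolding a_def by linarith+
      have "s (int (a r + i)) = (j + twos (z + (a r + i))) mod 2" using jz[OF ai(2)] by simp
      also have "twos (z + (a r + i)) = twos q + twos r + twos i"
        unfolding ai(1) using twos_block[OF i] twos_digit[OF r] twos_less_3[OF r] by simp
      finally have "s (int (a r + i)) = (j + twos q + twos r + twos i) mod 2" by (simp add: ac_simps)
      moreover have "(3::int) ^ (1 - n mod 2) = 2 + (-1) ^ n" for n
        by (cases "even n") (auto simp: even_iff_mod_2_eq_zero odd_iff_mod_2_eq_one)
      ultimately show "(3::int) ^ (1 - s (int (a r + i))) = 2 + (-1) ^ (j + twos q + twos r) * (-1) ^ twos i"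
        by (simp add: power_add)
    qed
    also have "\<dots> = 2 * int h + (-1) ^ (j + twos q + twos r) * int m"
      by (simp add: sum.distrib h(2) flip: sum_distrib_left)
    finally show ?thesis .
  qed
  have t: "twos 0 = 0" "twos 2 = 1" by (simp_all add: twos_less_3)
  show ?thesis
  \<comment> \<open>Thirds 0 and 2 have opposite signs since \<open>twos 0 = 0\<close> and
    \<open>twos 2 = 1\<close>; the parity decides which is the richer one and comes first.\<close>
  proof (cases "even (j + twos q)")
    case True
    thus ?thesis using block[of 0] block[of 2] t
      by (intro exI[of _ "int (a 0)"] exI[of _ "int (a 2) - int (a 0)"] exI[of _ "int h"]) simp
  next
    case False
    thus ?thesis using block[of 0] block[of 2] t
      by (intro exI[of _ "int (a 2)"] exI[of _ "int (a 0) - int (a 2)"] exI[of _ "int h"]) simp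
  qed
qed

text \<open>With fixed height and growing width, the row discrepancy beats the boundary, whose
  horizontal part costs only O(E) per unit of width.\<close>
lemma twos_rows_not_bd_lattice:
  assumes s2: "\<And>y. s y < 2"
    and win: "\<And>y n. \<exists>j z. \<forall>i<n. s (y + int i) = (j + twos (z + i)) mod 2"
    and L: "associated strip (range (row_tile s v)) L" and La: "lattice2 La"
  shows "\<not> bd_equiv L La"
proof
  assume "bd_equiv L La"
  then obtain E where E: "E \<ge> 0" "\<And>d. \<exists>\<Psi>. inj \<Psi> \<and> (\<forall>k y k' y'. \<Psi> (k, y) = (k', y') \<longrightarrow>
      \<bar>3 ^ s y' * k' - 3 ^ s y * k\<bar> \<le> E \<and> \<bar>y' - y - d\<bar> \<le> (E :: int))"
    using rows_almost_translation[OF s2 L _ La] by blast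
  \<comment> \<open>The level \<open>9 * E + 1\<close> makes the discrepancy exceed the boundary
    coefficient \<open>18 * E\<close> by 2.\<close>
  obtain y1 d h where h: "h \<ge> 0" and disc: "(\<Sum>y\<in>{y1..<y1 + h}. 3 ^ (1 - s y)) =
    (\<Sum>y\<in>{y1 + d..<y1 + d + h}. 3 ^ (1 - s y)) + 2 * int (nat (9 * E + 1))"
    using row_discrepancy[OF win] by blast
  obtain \<Psi> where \<Psi>: "inj \<Psi>" "\<And>k y k' y'. \<Psi> (k, y) = (k', y') \<Longrightarrow>
      \<bar>3 ^ s y' * k' - 3 ^ s y * k\<bar> \<le> E \<and> \<bar>y' - y - d\<bar> \<le> E"
    using E(2)[of d] by blast
  \<comment> \<open>The weaker bound \<open>3 * E\<close> matches the margins divisible by 3 in the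
    count.\<close>
  have \<Psi>3: "\<bar>3 ^ s y' * k' - 3 ^ s y * k\<bar> \<le> 3 * E \<and> \<bar>y' - y - d\<bar> \<le> 3 * E"
    if "\<Psi> (k, y) = (k', y')" for k y k' y' using \<Psi>(2)[OF that] E(1) by linarith
  define W where "W = (h + 6 * E) * (6 * E + 1)"
  have W: "W \<ge> 0" using h E(1) by (simp add: W_def)
  have bound: "2 * (9 * E + 1) * W' \<le> W + 18 * E * W'" if "W' \<ge> 0" for W'
    using row_count_le[where s = s and W = W' and E = E and h = h and \<Psi> = \<Psi> and d = d and ?y1.0 = y1] s2 that E(1) h \<Psi>(1) \<Psi>3 disc
    by (simp add: W_def algebra_simps)
  \<comment> \<open>After cancellation \<open>bound\<close> reads \<open>2 * W' \<le> W\<close>,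
    with \<open>W\<close> independent of the width, so \<open>W + 1\<close> is wide enough.\<close>
  have "2 * (W + 1) \<le> W" using bound[of "W + 1"] W by (simp add: algebra_simps)
  thus False using W by (simp add: algebra_simps)
qed

section \<open>The two row orders compared\<close>

theorem theorem1p2:
  shows "\<exists>n T \<xi>1 \<xi>2 \<rho>1 \<rho>2.
    prototiles n T \<and>
    subst_rule n T \<xi>1 \<rho>1 \<and> subst_rule n T \<xi>2 \<rho>2 \<and>
    primitive n \<rho>1 \<and> primitive n \<rho>2 \<and>
    (\<forall>i<n. \<forall>j<n. subst_matrix \<rho>1 i j = subst_matrix \<rho>2 i j) \<and>
    (\<forall>P\<in>tiling_space n T \<xi>1 \<rho>1. periodic_tiling P \<and>
       (\<forall>L. delone L \<and> associated T P L \<longrightarrow> (\<exists>La. lattice2 La \<and> bd_equiv L La))) \<and>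
    (\<forall>P\<in>tiling_space n T \<xi>2 \<rho>2. \<forall>L. delone L \<and> associated T P L \<longrightarrow>
       (\<forall>La. lattice2 La \<longrightarrow> \<not> bd_equiv L La)) \<and>
    (\<forall>P1\<in>tiling_space n T \<xi>1 \<rho>1. \<forall>P2\<in>tiling_space n T \<xi>2 \<rho>2. \<forall>L1 L2.
       delone L1 \<and> associated T P1 L1 \<and> delone L2 \<and> associated T P2 L2 \<longrightarrow>
       \<not> bd_equiv L1 L2)"
proof -
  let ?\<rho>1 = "row_rule id" and ?\<rho>2 = "row_rule twos"
  have parity: "id (3 * y + r) mod 2 = (id y + id r) mod 2" for y r :: nat by simp presburger
  have twos_add: "twos (3 * y + r) mod 2 = (twos y + twos r) mod 2" if "r < 3" for y r
    using twos_digit[OF that] twos_less_3[OF that] by simp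
  have id_0: "id (0::nat) = 0" by simp
  have rec1: "\<exists>i\<le>1. (j + id (z + i)) mod 2 = 1" for j z :: nat
  proof -
    have "(j + id (z + 0)) mod 2 = 1 \<or> (j + id (z + 1)) mod 2 = 1" by simp presburger
    thus ?thesis by (metis le_numeral_extra(4) zero_le)
  qed
  have rec2: "\<exists>i\<le>4. (j + twos (z + i)) mod 2 = 1" for j z
  proof -
    \<comment> \<open>The first multiple of 3 from \<open>z\<close> on is \<open>3 * n\<close>. Rows
      \<open>3 * n\<close> and \<open>3 * n + 2\<close> have different types and both lie within the
      next four steps.\<close>
    define n where "n = (z + 2) div 3"
    have n: "z \<le> 3 * n" "3 * n \<le> z + 2" by (simp_all add: n_def)
    have "twos (3 * n) = twos n" "twos (3 * n + 2) = twos n + 1"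
      using twos_digit[of 0 n] twos_digit[of 2 n] by simp_all
    hence "(j + twos (z + (3 * n - z))) mod 2 = 1 \<or> (j + twos (z + (3 * n + 2 - z))) mod 2 = 1"
      using n(1) by simp presburger
    moreover have "3 * n - z \<le> 4" "3 * n + 2 - z \<le> 4" using n by linarith+
    ultimately show ?thesis by blast
  qed
  have rows: "r < 3 \<longleftrightarrow> r = 0 \<or> r = 1 \<or> r = 2" for r :: nat by linarith
  have two: "i < 2 \<longleftrightarrow> i = 0 \<or> i = 1" for i :: nat by linarith
  have matrix: "\<forall>i<2. \<forall>j<2. subst_matrix ?\<rho>1 i j = subst_matrix ?\<rho>2 i j"
  proof (intro allI impI)
    fix i j :: nat assume ij: "i < 2" "j < 2"
    \<comment> \<open>Swapping rows 1 and 2 takes the parities 0, 1, 0 of \<open>id\<close> to the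
      parities 0, 0, 1 of \<open>twos\<close>.\<close>
    let ?f = "\<lambda>r::nat. if r = 1 then 2 else if r = 2 then 1 else r"
    have "bij_betw ?f {r. r < 3 \<and> (j + id r) mod 2 = i} {r. r < 3 \<and> (j + twos r) mod 2 = i}"
      by (rule bij_betw_byWitness[of _ ?f]) (auto simp: twos_less_3 rows)
    thus "subst_matrix ?\<rho>1 i j = subst_matrix ?\<rho>2 i j"
      using ij by (simp add: subst_matrix_row_rule bij_betw_same_card)
  qed
  have prim1: "primitive 2 ?\<rho>1"
  proof (rule primitive_row_rule)
    fix i j :: nat assume ij: "i < 2" "j < 2"
    have "(j + id 0) mod 2 = i \<or> (j + id 1) mod 2 = i" using ij by (auto simp: two)
    thus "\<exists>r<3. (j + id r) mod 2 = i" by (metis rows)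
  qed
  have prim2: "primitive 2 ?\<rho>2"
  proof (rule primitive_row_rule)
    fix i j :: nat assume ij: "i < 2" "j < 2"
    have "(j + twos 0) mod 2 = i \<or> (j + twos 2) mod 2 = i" using ij by (auto simp: two twos_less_3)
    thus "\<exists>r<3. (j + twos r) mod 2 = i" by (metis rows)
  qed
  have i: "periodic_tiling P \<and> (\<forall>L. associated strip P L \<longrightarrow> (\<exists>La. lattice2 La \<and> bd_equiv L La))"
    if P: "P \<in> tiling_space 2 strip 3 ?\<rho>1" for P
  proof -
    obtain s v where s: "P = range (row_tile s v)" "\<And>y. s y < 2"
      "\<And>y n. \<exists>j z. \<forall>i<n. s (y + int i) = (j + id (z + i)) mod 2"
      using tiling_space_rows[OF parity id_0 rec1 P] by metis
    have alt: "s y + s (y + 1) = 1" for y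
    proof -
      obtain j z where jz: "\<And>i. i < 2 \<Longrightarrow> s (y + int i) = (j + id (z + i)) mod 2" using s(3) by blast
      have "s y = (j + z) mod 2" "s (y + 1) = (j + (z + 1)) mod 2" using jz[of 0] jz[of 1] by simp_all
      thus ?thesis by presburger
    qed
    have "s (y + 2) = s y" for y using alt[of y] alt[of "y + 1"] by (simp add: add.assoc)
    hence "periodic_tiling P" unfolding s(1) by (intro periodic_rows s(2))
    moreover have "\<exists>La. lattice2 La \<and> bd_equiv L La" if L: "associated strip P L" for L
      by (rule alternating_rows_bd_lattice[OF _ L[unfolded s(1)]]) (rule alt)
    ultimately show ?thesis by blast
  qed
  have ii: "\<not> bd_equiv L La"
    if P: "P \<in> tiling_space 2 strip 3 ?\<rho>2" "associated strip P L" "lattice2 La" for P L La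
  proof -
    obtain s v where s: "P = range (row_tile s v)" "\<And>y. s y < 2"
      "\<And>y n. \<exists>j z. \<forall>i<n. s (y + int i) = (j + twos (z + i)) mod 2"
      using tiling_space_rows[OF twos_add twos_0 rec2 P(1)] by metis
    show ?thesis
      by (rule twos_rows_not_bd_lattice[OF _ _ P(2)[unfolded s(1)] P(3)]) (rule s(2), rule s(3))
  qed
  have iii: "\<not> bd_equiv L1 L2" if "P1 \<in> tiling_space 2 strip 3 ?\<rho>1" "P2 \<in> tiling_space 2 strip 3 ?\<rho>2"
    "associated strip P1 L1" "associated strip P2 L2" for P1 P2 L1 L2
    using i[OF that(1)] ii[OF that(2,4)] that(3) bd_equiv_euclidean by blast
  show ?thesis
    by (rule exI[of _ 2], rule exI[of _ strip], rule exI[of _ 3], rule exI[of _ 3],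
        rule exI[of _ ?\<rho>1], rule exI[of _ ?\<rho>2])
      (use prototiles_strip subst_rule_row_rule prim1 prim2 matrix i ii iii in blast)
qed

end
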